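(* Let $N\ge 1$, let $\mathscr{P}=\{\mathbf{P}_{0}=\mathbf{p}_{0}\cdot\mu,\ldots,\mathbf{P}_{N}=\mathbf{p}_{N}\cdot\mu\}$ be a family of $N+1$ distinct probabilities dominated by a measure $\mu$ on a measurable space $(\mathbf{E},\mathcal{E})$, and put $\mathcal{J}=\{0,\ldots,N\}$. Let $$\overline{\mathcal{R}}(\mathscr{P})=\sup_{\widehat T}\ \inf_{j\in\mathcal{J}}\mathbf{P}_{j}\left[\widehat T(\boldsymbol{X})=j\right],\qquad \overline{\mathcal{B}}(\mathscr{P})=\sup_{\widehat T}\ \frac{1}{N+1}\sum_{j=0}^{N}\mathbf{P}_{j}\left[\widehat T(\boldsymbol{X})=j\right],$$ where the suprema run over all estimators $\widehat T(\boldsymbol{X})$ with values in $\mathcal{J}$. Then for all $\lambda>0$ and all probabilities $\mathbf{Q}=\mathbf{q}\cdot\mu$ that dominate $\mathscr{P}$, $$\overline{\mathcal{R}}(\mathscr{P})\le\overline{\mathcal{B}}(\mathscr{P})\le \frac{1}{N+1}\left[\sum_{j=0}^{N}\int_{\mathbf{E}}\mathbf{p}_{j}^{1+\lambda}\,\mathbf{q}^{-\lambda}\,d\mu\right]^{1/(1+\lambda)}.$$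
   Context: The notation $\mathbf{P}=\mathbf{p}\cdot\mu$ means that $\mathbf{P}$ is the probability on $(\mathbf{E},\mathcal{E})$ with density $\mathbf{p}$ with respect to $\mu$. The observation $\boldsymbol{X}$ takes its values in $\mathbf{E}$, and $\mathbf{P}_{j}[\widehat T(\boldsymbol{X})=j]$ is the probability of the event when $\boldsymbol{X}$ has distribution $\mathbf{P}_{j}$. An estimator with values in $\mathcal{J}$ is a measurable function $\widehat T:\mathbf{E}\to\mathcal{J}$ evaluated at $\boldsymbol{X}$. The probability $\mathbf{Q}$ dominates $\mathscr{P}$ if $\mathbf{P}_{j}\ll\mathbf{Q}$ for all $j\in\mathcal{J}$. The integrand $\mathbf{p}_{j}^{1+\lambda}\mathbf{q}^{-\lambda}$ is taken to be $0$ where $\mathbf{q}=0$ (there $\mathbf{p}_{j}=0$ $\mu$-almost everywhere). The integrals may equal $+\infty$, in which case the bound is trivial. *)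

theory Defs
  imports "HOL-Probability.Probability"
begin

text \<open>Only the \<open>\<sigma>\<close>-algebra of \<open>M\<close> matters in the next three definitions.\<close>

definition estimators :: "'a measure \<Rightarrow> nat \<Rightarrow> ('a \<Rightarrow> nat) set" where
  "estimators M N = M \<rightarrow>\<^sub>M count_space {0..N}"

definition R_bar :: "'a measure \<Rightarrow> nat \<Rightarrow> (nat \<Rightarrow> 'a measure) \<Rightarrow> ennreal" where
  "R_bar M N P =
     (SUP T\<in>estimators M N. INF j\<in>{0..N}. emeasure (P j) {x \<in> space M. T x = j})"

definition B_bar :: "'a measure \<Rightarrow> nat \<Rightarrow> (nat \<Rightarrow> 'a measure) \<Rightarrow> ennreal" where
  "B_bar M N P =
     (SUP T\<in>estimators M N.
        1 / of_nat (N + 1) * (\<Sum>j=0..N. emeasure (P j) {x \<in> space M. T x = j}))"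

text \<open>Real powers on \<open>[0,\<infinity>]\<close>, with \<open>\<infinity>\<close> to the power \<open>a\<close> equal to \<open>\<infinity>\<close>;
  only meaningful for exponents \<open>a > 0\<close>.\<close>

definition ennpowr :: "ennreal \<Rightarrow> real \<Rightarrow> ennreal" where
  "ennpowr x a = (if x = \<infinity> then \<infinity> else ennreal (enn2real x powr a))"

text \<open>Since \<open>0 powr a = 0\<close> for every \<open>a\<close>, the integrand is \<open>0\<close> wherever \<open>q\<close> vanishes.\<close>

definition power_integral :: "'a measure \<Rightarrow> real \<Rightarrow> ('a \<Rightarrow> real) \<Rightarrow> ('a \<Rightarrow> real) \<Rightarrow> ennreal" where
  "power_integral M l p q = (\<integral>\<^sup>+ x. ennreal (p x powr (1 + l) * q x powr (- l)) \<partial>M)"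

definition prob_with_density :: "'a measure \<Rightarrow> 'a measure \<Rightarrow> ('a \<Rightarrow> real) \<Rightarrow> bool" where
  "prob_with_density M P p \<longleftrightarrow>
     p \<in> borel_measurable M \<and> (\<forall>x\<in>space M. 0 \<le> p x) \<and>
     P = density M (\<lambda>x. ennreal (p x)) \<and> prob_space P"

end

theory Submission
  imports Defs
begin

text \<open>
  The total success \<open>S = \<Sum>j. P j (T = j)\<close> is an integral of \<open>p j\<close> over the cell \<open>{T = j}\<close>,
  summed over the cells, so the upper bound is an instance of Jensen's inequality for
  \<open>u \<mapsto> u powr (1 + l)\<close> under \<open>Q\<close>: the function that equals \<open>p j / q\<close> on \<open>{T = j}\<close> has \<open>Q\<close>-mean \<open>S\<close>,
  and its power of order \<open>1 + l\<close> has \<open>Q\<close>-mean at most the sum of the power integrals.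

  Jensen's inequality is used through the tangent line at \<open>t\<close>. Where \<open>q > 0\<close>, Young's
  inequality says \<open>(1 + l) * t powr l * p \<le> p powr (1 + l) * q powr (- l) + l * t powr (1 + l) * q\<close>
  (\<open>tangent_powr_bound\<close>), and where \<open>q = 0\<close> domination forces \<open>p = 0\<close> almost everywhere.
  This is integrated over each cell (\<open>emeasure_tangent_bound\<close>). The cells are disjoint, so their \<open>Q\<close>-probabilities add up to at most
  \<open>1\<close>; taking \<open>t = S\<close> leaves \<open>S powr (1 + l) \<le> \<Sum>j. power_integral M l (p j) q\<close>
  (\<open>sum_emeasure_le_power_integral\<close>). The inequality \<open>R_bar M N P \<le> B_bar M N P\<close> holds estimator by estimator,
  because a minimum is at most the average.
\<close>

text \<open>Weighted arithmetic-geometric mean inequality for \<open>a powr (1 + l) * b powr (- l)\<close> and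
  \<open>t powr (1 + l) * b\<close>, with weights \<open>1 / (1 + l)\<close> and \<open>l / (1 + l)\<close> chosen so that the powers
  of \<open>b\<close> cancel in the geometric mean.\<close>

lemma tangent_powr_bound:
  fixes a b l t :: real
  assumes "0 \<le> a" "0 < b" "0 < l" "0 \<le> t"
  shows "(1 + l) * t powr l * a \<le> a powr (1 + l) * b powr (- l) + l * t powr (1 + l) * b"
proof (cases "a = 0 \<or> t = 0")
  case True
  with assms show ?thesis by auto
next
  case False
  define x y where "x = a powr (1 + l) * b powr (- l)" and "y = t powr (1 + l) * b"
  have "x powr (1 / (1 + l)) * y powr (l / (1 + l)) \<le> 1 / (1 + l) * x + l / (1 + l) * y"
    using assms False by (intro Youngs_inequality_0) (auto simp: x_def y_def field_simps)
  moreover have "x powr (1 / (1 + l)) = a * b powr (- (l / (1 + l)))"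
    using assms by (simp add: x_def powr_mult powr_powr)
  moreover have "y powr (l / (1 + l)) = t powr l * b powr (l / (1 + l))"
    using assms by (simp add: y_def powr_mult powr_powr)
  moreover have "b powr (- (l / (1 + l))) * b powr (l / (1 + l)) = 1"
    using assms by (simp add: powr_add[symmetric])
  ultimately have "a * t powr l \<le> 1 / (1 + l) * x + l / (1 + l) * y"
    by (simp add: mult_ac)
  then have "(1 + l) * (a * t powr l) \<le> (1 + l) * (1 / (1 + l) * x + l / (1 + l) * y)"
    using assms by (intro mult_left_mono) auto
  also have "\<dots> = x + l * y"
    using assms by (simp add: distrib_left)
  finally show ?thesis
    by (simp add: x_def y_def mult_ac)
qed

text \<open>The set \<open>{q = 0}\<close> is null for \<open>Q\<close>, hence for \<open>P\<close>, so the integral of \<open>p\<close> over it vanishes.\<close>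

lemma AE_density_eq_0:
  assumes p: "prob_with_density M P p" and q: "prob_with_density M Q q"
    and ac: "absolutely_continuous Q P"
  shows "AE x in M. q x = 0 \<longrightarrow> p x = 0"
proof -
  have [measurable]: "p \<in> borel_measurable M" "q \<in> borel_measurable M"
    and P: "P = density M (\<lambda>x. ennreal (p x))" and Q: "Q = density M (\<lambda>x. ennreal (q x))"
    and p0: "\<And>x. x \<in> space M \<Longrightarrow> 0 \<le> p x"
    using p q by (auto simp: prob_with_density_def)
  have "AE x in Q. q x \<noteq> 0"
    unfolding Q by (subst AE_density) auto
  then have "AE x in P. q x \<noteq> 0"
    by (rule absolutely_continuous_AE[rotated 2]) (use ac P Q in auto)
  then have "AE x in M. 0 < ennreal (p x) \<longrightarrow> q x \<noteq> 0"
    unfolding P by (subst (asm) AE_density) auto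
  with AE_space show ?thesis
    by eventually_elim (use p0 in \<open>force simp: less_le\<close>)
qed

text \<open>The tangent line inequality integrated over \<open>A\<close>. The term with the \<open>Q\<close>-measure keeps its
  restriction to \<open>A\<close>, since its sum over disjoint sets must stay bounded by its integral over
  the whole space; the power integral is enlarged to the whole space at once.\<close>

lemma emeasure_tangent_bound:
  assumes p: "prob_with_density M P p" and q: "prob_with_density M Q q"
    and ac: "absolutely_continuous Q P" and l: "0 < l" and t: "0 \<le> t"
    and A[measurable]: "A \<in> sets M"
  shows "ennreal ((1 + l) * t powr l) * emeasure P A
    \<le> power_integral M l p q + ennreal (l * t powr (1 + l)) * emeasure Q A"
proof -
  have [measurable]: "p \<in> borel_measurable M" "q \<in> borel_measurable M"
    and P: "P = density M (\<lambda>x. ennreal (p x))" and Q: "Q = density M (\<lambda>x. ennreal (q x))"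
    and p0: "\<And>x. x \<in> space M \<Longrightarrow> 0 \<le> p x" and q0: "\<And>x. x \<in> space M \<Longrightarrow> 0 \<le> q x"
    using p q by (auto simp: prob_with_density_def)
  let ?f = "\<lambda>x. ennreal (p x powr (1 + l) * q x powr (- l))"
  have "ennreal ((1 + l) * t powr l) * emeasure P A
      = (\<integral>\<^sup>+x. ennreal ((1 + l) * t powr l) * (ennreal (p x) * indicator A x) \<partial>M)"
    by (simp add: P emeasure_density nn_integral_cmult)
  also have "\<dots> \<le> (\<integral>\<^sup>+x. ?f x + ennreal (l * t powr (1 + l)) * (ennreal (q x) * indicator A x) \<partial>M)"
  proof (rule nn_integral_mono_AE)
    show "AE x in M. ennreal ((1 + l) * t powr l) * (ennreal (p x) * indicator A x)
        \<le> ?f x + ennreal (l * t powr (1 + l)) * (ennreal (q x) * indicator A x)"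
      using AE_density_eq_0[OF p q ac] AE_space
    proof eventually_elim
      fix x assume zero: "q x = 0 \<longrightarrow> p x = 0" and x: "x \<in> space M"
      have "(1 + l) * t powr l * p x
          \<le> p x powr (1 + l) * q x powr (- l) + l * t powr (1 + l) * q x"
      proof (cases "q x = 0")
        case True
        with zero show ?thesis by simp
      next
        case False
        with q0[OF x] p0[OF x] l t show ?thesis
          by (intro tangent_powr_bound) auto
      qed
      then have "ennreal ((1 + l) * t powr l * p x)
          \<le> ennreal (p x powr (1 + l) * q x powr (- l) + l * t powr (1 + l) * q x)"
        by (rule ennreal_leI)
      then show "ennreal ((1 + l) * t powr l) * (ennreal (p x) * indicator A x)
        \<le> ?f x + ennreal (l * t powr (1 + l)) * (ennreal (q x) * indicator A x)"
        using l p0[OF x] q0[OF x]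
        by (auto simp: ennreal_mult' ennreal_plus split: split_indicator)
    qed
  qed
  also have "\<dots> = power_integral M l p q + ennreal (l * t powr (1 + l)) * emeasure Q A"
    by (simp add: Q emeasure_density nn_integral_cmult nn_integral_add power_integral_def)
  finally show ?thesis .
qed

text \<open>Jensen's inequality: the tangent line is taken at \<open>t = s\<close>, the \<open>Q\<close>-mean itself, where the
  linear bound is sharp. This choice is possible because \<open>s\<close> is finite.\<close>

lemma sum_emeasure_le_power_integral:
  fixes P :: "'i \<Rightarrow> 'a measure" and p :: "'i \<Rightarrow> 'a \<Rightarrow> real"
  assumes fin: "finite J"
    and p: "\<And>j. j \<in> J \<Longrightarrow> prob_with_density M (P j) (p j)"
    and q: "prob_with_density M Q q"
    and ac: "\<And>j. j \<in> J \<Longrightarrow> absolutely_continuous Q (P j)"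
    and l: "0 < l"
    and A: "\<And>j. j \<in> J \<Longrightarrow> A j \<in> sets M" and disj: "disjoint_family_on A J"
  shows "(\<Sum>j\<in>J. emeasure (P j) (A j))
    \<le> ennpowr (\<Sum>j\<in>J. power_integral M l (p j) q) (1 / (1 + l))"
proof (cases "(\<Sum>j\<in>J. power_integral M l (p j) q) = \<infinity>")
  case True
  then show ?thesis by (simp add: ennpowr_def)
next
  case False
  define I where "I = enn2real (\<Sum>j\<in>J. power_integral M l (p j) q)"
  define s where "s = (\<Sum>j\<in>J. measure (P j) (A j))"
  have I: "(\<Sum>j\<in>J. power_integral M l (p j) q) = ennreal I"
    using False by (simp add: I_def less_top)
  have I0: "0 \<le> I" by (simp add: I_def)
  have prob: "prob_space (P j)" if "j \<in> J" for j
    using p[OF that] unfolding prob_with_density_def by blast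
  have s0: "0 \<le> s" by (simp add: s_def sum_nonneg)
  have s: "(\<Sum>j\<in>J. emeasure (P j) (A j)) = ennreal s"
  proof -
    have "(\<Sum>j\<in>J. emeasure (P j) (A j)) = (\<Sum>j\<in>J. ennreal (measure (P j) (A j)))"
      using prob by (intro sum.cong refl finite_measure.emeasure_eq_measure)
        (auto simp: prob_space_def)
    then show ?thesis by (simp add: s_def sum_ennreal)
  qed
  have Q_le: "(\<Sum>j\<in>J. emeasure Q (A j)) \<le> 1"
  proof -
    have "prob_space Q" and sets: "sets Q = sets M"
      using q by (auto simp: prob_with_density_def)
    then interpret Q: prob_space Q by simp
    have "(\<Sum>j\<in>J. emeasure Q (A j)) = emeasure Q (\<Union>j\<in>J. A j)"
      using A by (intro sum_emeasure fin disj) (auto simp: sets)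
    then show ?thesis using Q.emeasure_le_1 by simp
  qed
  have "ennreal ((1 + l) * s powr l * s) = ennreal ((1 + l) * s powr l) * ennreal s"
    using l s0 by (simp add: ennreal_mult)
  also have "\<dots> = (\<Sum>j\<in>J. ennreal ((1 + l) * s powr l) * emeasure (P j) (A j))"
    by (simp add: s[symmetric] sum_distrib_left)
  also have "\<dots> \<le> (\<Sum>j\<in>J. power_integral M l (p j) q + ennreal (l * s powr (1 + l)) * emeasure Q (A j))"
    using p q ac l s0 A by (intro sum_mono emeasure_tangent_bound)
  also have "\<dots> = ennreal I + ennreal (l * s powr (1 + l)) * (\<Sum>j\<in>J. emeasure Q (A j))"
    by (simp add: sum.distrib sum_distrib_left I)
  also have "\<dots> \<le> ennreal I + ennreal (l * s powr (1 + l)) * 1"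
    using Q_le by (intro add_left_mono mult_left_mono) auto
  also have "\<dots> = ennreal (I + l * s powr (1 + l))"
    using I0 l by (simp add: ennreal_plus)
  finally have "(1 + l) * s powr l * s \<le> I + l * s powr (1 + l)"
    using I0 l by (subst (asm) ennreal_le_iff) auto
  moreover have "s powr l * s = s powr (1 + l)"
    using s0 by (cases "s = 0") (auto simp: powr_add)
  ultimately have "s powr (1 + l) \<le> I"
    by (simp add: algebra_simps)
  then have "(s powr (1 + l)) powr (1 / (1 + l)) \<le> I powr (1 / (1 + l))"
    using l by (intro powr_mono2) auto
  then have "s \<le> I powr (1 / (1 + l))"
    using s0 l by (simp add: powr_powr)
  then show ?thesis
    using False by (simp add: s ennpowr_def I_def ennreal_leI)
qed

lemma INF_le_average:
  fixes f :: "nat \<Rightarrow> ennreal"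
  shows "(INF j\<in>{0..N}. f j) \<le> 1 / of_nat (N + 1) * (\<Sum>j=0..N. f j)"
proof -
  let ?i = "INF j\<in>{0..N}. f j"
  have "(1 / of_nat (N + 1) :: ennreal) * of_nat (N + 1) = 1"
    by (subst mult.commute, rule ennreal_times_divide[THEN trans])
      (simp del: of_nat_Suc of_nat_add add: ennreal_divide_self of_nat_less_top)
  then have "?i = 1 / of_nat (N + 1) * (of_nat (N + 1) * ?i)"
    by (simp add: mult.assoc[symmetric] del: of_nat_Suc of_nat_add)
  also have "of_nat (N + 1) * ?i = (\<Sum>j=0..N. ?i)"
    by simp
  also have "1 / of_nat (N + 1) * \<dots> \<le> 1 / of_nat (N + 1) * (\<Sum>j=0..N. f j)"
    by (intro mult_left_mono sum_mono INF_lower) auto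
  finally show ?thesis .
qed

theorem mainTheorem2:
  fixes M :: "'a measure" and N :: nat
    and P :: "nat \<Rightarrow> 'a measure" and p :: "nat \<Rightarrow> 'a \<Rightarrow> real"
    and Q :: "'a measure" and q :: "'a \<Rightarrow> real" and l :: real
  assumes "N \<ge> 1"
    and "\<And>j. j \<in> {0..N} \<Longrightarrow> prob_with_density M (P j) (p j)"
    and "inj_on P {0..N}"
    and "l > 0"
    and "prob_with_density M Q q"
    and "\<And>j. j \<in> {0..N} \<Longrightarrow> absolutely_continuous Q (P j)"
  shows "R_bar M N P \<le> B_bar M N P \<and>
    B_bar M N P \<le>
      1 / of_nat (N + 1) * ennpowr (\<Sum>j=0..N. power_integral M l (p j) q) (1 / (1 + l))"
proof
  show "R_bar M N P \<le> B_bar M N P"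
    unfolding R_bar_def B_bar_def by (intro SUP_mono' INF_le_average)
  show "B_bar M N P \<le>
      1 / of_nat (N + 1) * ennpowr (\<Sum>j=0..N. power_integral M l (p j) q) (1 / (1 + l))"
    unfolding B_bar_def
  proof (intro SUP_least mult_left_mono)
    fix T assume "T \<in> estimators M N"
    then have T[measurable]: "T \<in> M \<rightarrow>\<^sub>M count_space {0..N}"
      by (simp add: estimators_def)
    show "(\<Sum>j=0..N. emeasure (P j) {x \<in> space M. T x = j})
        \<le> ennpowr (\<Sum>j=0..N. power_integral M l (p j) q) (1 / (1 + l))"
    proof (rule sum_emeasure_le_power_integral)
      show "{x \<in> space M. T x = j} \<in> sets M" if "j \<in> {0..N}" for j
      proof -
        have "{x \<in> space M. T x = j} = T -` {j} \<inter> space M" by auto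
        also have "\<dots> \<in> sets M" using that by (intro measurable_sets[OF T]) auto
        finally show ?thesis .
      qed
      show "disjoint_family_on (\<lambda>j. {x \<in> space M. T x = j}) {0..N}"
        by (auto simp: disjoint_family_on_def)
    qed (use assms in auto)
  qed auto
qed

end
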